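(* Let $G:\mathbb{R}^p\to\mathbb{R}^p$, let $\theta_k\in(0,1)$, $\eta_k>0$, $\gamma_k\in(0,1)$ ($k\ge0$) be given, and let $x^0\in\mathrm{dom}(G)$. Set $z^0=z^{-1}:=x^0$, $w^0=w^{-1}:=0$, $c_0=c_{-1}:=0$, $\tau_0:=1$, $\tau_{k+1}:=\tau_k\theta_k$ for $k\ge0$, and $c_k:=c_{k-1}+\tau_k$ for $k\ge1$. At each iteration $k\ge0$ update $$d_{i_k}^k:=[G(z^k+c_kw^k)]_{i_k}-\gamma_k[G(z^{k-1}+c_{k-1}w^{k-1})]_{i_k},$$ $$w_i^{k+1}:=\begin{cases} w_i^k-\frac{\eta_k}{\mathbf{p}_i\tau_{k+1}}d_i^k, & i=i_k, \\ w_i^k, & \text{otherwise}, \end{cases}\qquad z_i^{k+1}:=\begin{cases} z_i^k+\frac{\eta_kc_k}{\mathbf{p}_i\tau_{k+1}}d_i^k, & i=i_k, \\ z_i^k, & \text{otherwise}. \end{cases}$$ Then $x^k:=z^k+c_kw^k$ is identical, for all $k\ge0$, to the iterate generated by the ARCOG scheme started from $x^0$ (with the same $i_k,\theta_k,\eta_k,\gamma_k$).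
   Context: Vectors $x\in\mathbb{R}^p$ are decomposed into $n$ blocks $x=[x_1,\dots,x_n]$, $x_i\in\mathbb{R}^{p_i}$, $\sum_ip_i=p$. $[Gx]_i$ is the $i$-th block of $Gx$ and $G_{[i]}x:=[0,\dots,0,[Gx]_i,0,\dots,0]$; $G$ is single-valued with $\mathrm{dom}(G)=\mathbb{R}^p$. $\mathbf{p}_1,\dots,\mathbf{p}_n>0$, $\sum_i\mathbf{p}_i=1$, and $i_k\in\{1,\dots,n\}$ are random indices with $\mathbf{Prob}(i_k=i)=\mathbf{p}_i$. ARCOG scheme: $x^{-1}:=x^0$ and for $k\ge0$ $$x^{k+1}:=x^k+\theta_k(x^k-x^{k-1})-\frac{\eta_k}{\mathbf{p}_{i_k}}\big(G_{[i_k]}x^k-\gamma_kG_{[i_k]}x^{k-1}\big).$$ *)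

theory Defs
  imports "HOL-Probability.Probability"
begin

text \<open>
  The block structure of \<open>\<real>\<^sup>p\<close> is given by a map \<open>blk\<close> sending each coordinate to the index of
  the block containing it: block \<open>i\<close> of \<open>v\<close> consists of the entries \<open>v $ j\<close> with \<open>blk j = i\<close>, and
  \<open>p\<^sub>i\<close> is the number of such \<open>j\<close>.  \<open>block_part blk i v\<close> is \<open>[0, ..., 0, v\<^sub>i, 0, ..., 0]\<close>, so that
  \<open>block_part blk i (G x)\<close> is \<open>G_[i] x\<close>.
\<close>

definition block_part :: "('p \<Rightarrow> 'n) \<Rightarrow> 'n \<Rightarrow> real ^ 'p \<Rightarrow> real ^ 'p" where
  "block_part blk i v = (\<chi> j. if blk j = i then v $ j else 0)"

text \<open>
  Here \<open>ix\<close> is one realisation of the index sequence \<open>i\<^sub>0, i\<^sub>1, ...\<close>.  The sequences below are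
  indexed by \<open>nat\<close>, where \<open>0 - 1 = 0\<close>.  An index \<open>k - 1\<close> therefore reads the entry at \<open>0\<close> when
  \<open>k = 0\<close>, which is exactly the convention that the entry at \<open>-1\<close> equals the entry at \<open>0\<close>; it
  holds for all of \<open>x\<close>, \<open>z\<close>, \<open>w\<close> and \<open>c\<close>.
\<close>

context
  fixes blk :: "'p::finite \<Rightarrow> 'n" and prb :: "'n \<Rightarrow> real"
    and G :: "real ^ 'p \<Rightarrow> real ^ 'p"
    and \<theta> \<eta> \<gamma> :: "nat \<Rightarrow> real" and x0 :: "real ^ 'p" and ix :: "nat \<Rightarrow> 'n"
begin

fun arcog_x :: "nat \<Rightarrow> real ^ 'p" where
  "arcog_x 0 = x0"
| "arcog_x (Suc k) =
     arcog_x k + \<theta> k *\<^sub>R (arcog_x k - arcog_x (k - 1))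
     - (\<eta> k / prb (ix k)) *\<^sub>R
         (block_part blk (ix k) (G (arcog_x k))
          - \<gamma> k *\<^sub>R block_part blk (ix k) (G (arcog_x (k - 1))))"

primrec tau :: "nat \<Rightarrow> real" where
  "tau 0 = 1"
| "tau (Suc k) = tau k * \<theta> k"

primrec cc :: "nat \<Rightarrow> real" where
  "cc 0 = 0"
| "cc (Suc k) = cc k + tau (Suc k)"

text \<open>
  \<open>d\<close> is a full vector, of which only the entries in block \<open>ix k\<close> are read.
\<close>

fun coord_z coord_w :: "nat \<Rightarrow> real ^ 'p" where
  "coord_z 0 = x0"
| "coord_w 0 = 0"
| "coord_z (Suc k) =
     (let d = G (coord_z k + cc k *\<^sub>R coord_w k)
              - \<gamma> k *\<^sub>R G (coord_z (k - 1) + cc (k - 1) *\<^sub>R coord_w (k - 1))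
      in \<chi> j. if blk j = ix k
              then coord_z k $ j + \<eta> k * cc k / (prb (blk j) * tau (Suc k)) * d $ j
              else coord_z k $ j)"
| "coord_w (Suc k) =
     (let d = G (coord_z k + cc k *\<^sub>R coord_w k)
              - \<gamma> k *\<^sub>R G (coord_z (k - 1) + cc (k - 1) *\<^sub>R coord_w (k - 1))
      in \<chi> j. if blk j = ix k
              then coord_w k $ j - \<eta> k / (prb (blk j) * tau (Suc k)) * d $ j
              else coord_w k $ j)"

end

end

theory Submission
  imports Defs
begin

text \<open>
  The increments of \<open>z\<close> and of \<open>c\<^sub>k w\<close> in one step cancel, so
  \<open>x\<^bsup>k+1\<^esup> = x\<^bsup>k\<^esup> + \<tau>\<^bsub>k+1\<^esub> w\<^bsup>k+1\<^esup>\<close>: the scaled vector \<open>\<tau>\<^sub>k w\<^bsup>k\<^esup>\<close> is the momentum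
  \<open>x\<^bsup>k\<^esup> - x\<^bsup>k-1\<^esup>\<close>. Since \<open>\<tau>\<^bsub>k+1\<^esub> = \<theta>\<^sub>k \<tau>\<^sub>k\<close>, multiplying the update of \<open>w\<close> by \<open>\<tau>\<^bsub>k+1\<^esub>\<close>
  turns it into the ARCOG step.
\<close>

context
  fixes blk :: "'p::finite \<Rightarrow> 'n" and prb :: "'n \<Rightarrow> real"
    and G :: "real ^ 'p \<Rightarrow> real ^ 'p"
    and \<theta> \<eta> \<gamma> :: "nat \<Rightarrow> real" and x0 :: "real ^ 'p" and ix :: "nat \<Rightarrow> 'n"
begin

private abbreviation (input) "z \<equiv> coord_z blk prb G \<theta> \<eta> \<gamma> x0 ix"
private abbreviation (input) "w \<equiv> coord_w blk prb G \<theta> \<eta> \<gamma> x0 ix"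
private abbreviation (input) "y k \<equiv> z k + cc \<theta> k *\<^sub>R w k"

lemma coord_frozen_combination:
  "z (Suc k) + cc \<theta> k *\<^sub>R w (Suc k) = y k"
  by (simp add: vec_eq_iff Let_def right_diff_distrib)

lemma coord_increment:
  "y (Suc k) = y k + tau \<theta> (Suc k) *\<^sub>R w (Suc k)"
  unfolding cc.simps scaleR_add_left coord_frozen_combination[symmetric] by (simp only: add.assoc)

lemma coord_momentum:
  "tau \<theta> k *\<^sub>R w k = y k - y (k - 1)"
proof (cases k)
  case (Suc m)
  then show ?thesis
    using coord_increment[of m] by (metis add_diff_cancel_left' diff_Suc_1)
\<comment> \<open>For \<open>k = 0\<close> both sides vanish: \<open>w 0 = 0\<close>, and
  \<open>0 - 1 = 0\<close> on naturals.\<close>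
qed simp

lemma tau_pos:
  assumes "\<And>k. \<theta> k > 0"
  shows "tau \<theta> k > 0"
  by (induction k) (simp_all add: assms)

text \<open>On block \<open>ix k\<close> the factor \<open>tau \<theta> (Suc k)\<close> cancels the
  denominator in the update of \<open>w\<close>, and \<open>prb (blk j)\<close> is
  \<open>prb (ix k)\<close>; off that block \<open>w\<close> is unchanged and both block parts
  vanish.\<close>

lemma scaled_coord_w_Suc:
  assumes "tau \<theta> (Suc k) \<noteq> 0"
  shows "tau \<theta> (Suc k) *\<^sub>R w (Suc k) =
    \<theta> k *\<^sub>R tau \<theta> k *\<^sub>R w k
    - (\<eta> k / prb (ix k)) *\<^sub>R
        (block_part blk (ix k) (G (y k)) - \<gamma> k *\<^sub>R block_part blk (ix k) (G (y (k - 1))))"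
  using assms by (simp add: vec_eq_iff Let_def block_part_def right_diff_distrib)

lemma coord_eq_arcog:
  assumes "\<And>k. \<theta> k > 0"
  shows "y k = arcog_x blk prb G \<theta> \<eta> \<gamma> x0 ix k"
\<comment> \<open>The recursion looks back two steps, so the claim is needed at both
  \<open>m\<close> and \<open>m - 1\<close>; for \<open>m = 0\<close> these coincide.\<close>
proof (induction k rule: less_induct)
  case (less k)
  show ?case
  proof (cases k)
    case (Suc m)
    have "tau \<theta> (Suc m) \<noteq> 0"
      using tau_pos[OF assms, of "Suc m"] by (rule less_imp_neq[THEN not_sym])
    from scaled_coord_w_Suc[OF this] have "y (Suc m) = y m + \<theta> m *\<^sub>R (y m - y (m - 1))
        - (\<eta> m / prb (ix m)) *\<^sub>R
            (block_part blk (ix m) (G (y m)) - \<gamma> m *\<^sub>R block_part blk (ix m) (G (y (m - 1))))"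
      unfolding coord_increment coord_momentum[of m, symmetric]
      by (simp only: add_diff_eq)
    moreover have "y m = arcog_x blk prb G \<theta> \<eta> \<gamma> x0 ix m"
      "y (m - 1) = arcog_x blk prb G \<theta> \<eta> \<gamma> x0 ix (m - 1)"
      using less Suc by simp_all
    ultimately show ?thesis
      by (simp only: Suc arcog_x.simps)
  qed simp
qed

end

theorem proposition1:
  fixes M :: "'w measure" and I :: "nat \<Rightarrow> 'w \<Rightarrow> 'n::finite"
    and blk :: "'p::finite \<Rightarrow> 'n" and prb :: "'n \<Rightarrow> real"
    and G :: "real ^ 'p \<Rightarrow> real ^ 'p" and x0 :: "real ^ 'p"
    and \<theta> \<eta> \<gamma> :: "nat \<Rightarrow> real"
  assumes "prob_space M"
    and "\<And>i. prb i > 0" and "(\<Sum>i\<in>UNIV. prb i) = 1"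
    and "\<And>k. I k \<in> measurable M (count_space UNIV)"
    and "\<And>k i. measure M {\<omega> \<in> space M. I k \<omega> = i} = prb i"
    and "\<And>k. \<theta> k \<in> {0<..<1}" and "\<And>k. \<eta> k > 0" and "\<And>k. \<gamma> k \<in> {0<..<1}"
  shows "\<forall>\<omega>\<in>space M. \<forall>k.
    coord_z blk prb G \<theta> \<eta> \<gamma> x0 (\<lambda>m. I m \<omega>) k
      + cc \<theta> k *\<^sub>R coord_w blk prb G \<theta> \<eta> \<gamma> x0 (\<lambda>m. I m \<omega>) k
    = arcog_x blk prb G \<theta> \<eta> \<gamma> x0 (\<lambda>m. I m \<omega>) k"
  \<comment> \<open>The identity is pathwise: each outcome fixes one index sequence.\<close>
  using assms(6) by (simp add: coord_eq_arcog)

end
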